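(* Let $m\ge1$, $a_1,\ldots,a_m\in\mathbb Z$, and let $f:\mathbb N\to\mathbb Z$ satisfy $k^3\mid f(k)$ for all $k\in\mathbb N$. Then for any positive integer $n$, $$\sum_{k=0}^{n-1}\big(f(k+1)-f(k)\big)\prod_{i=1}^m\binom{a_in-1}{k}\binom{-a_in-1}k\equiv n^2(a_1^2+\cdots+a_m^2)\sum_{0<k<n}\frac{f(k)}{k^2}\prod_{i=1}^m\binom{a_in-1}k\binom{-a_in-1}k\pmod {n^3}.$$
   Context: For an integer $x$ and $k\in\mathbb N$, $\binom xk=x(x-1)\cdots(x-k+1)/k!$. *)

theory Defs
  imports Complex_Main "HOL-Number_Theory.Cong"
begin

text \<open>
  The library's \<open>gchoose\<close> does make sense on \<^typ>\<open>int\<close>, but below \<open>Complex_Main\<close> its sort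
  constraint may be \<open>field_char_0\<close>, depending on the order of imports, and then \<open>x gchoose k\<close> with
  \<open>x :: int\<close> cannot be written down. Hence the instance at \<^typ>\<open>int\<close> gets a name of its own.
  The division is exact, see \<open>zchoose_mult_fact\<close>.
\<close>

definition zchoose :: "int \<Rightarrow> nat \<Rightarrow> int"  (infix "zchoose" 64)
  where "x zchoose k = (\<Prod>i = 0..<k. x - of_nat i) div fact k"

lemmas zchoose_eq_gbinomial =
  trans [OF zchoose_def gbinomial_prod_rev [where 'a = int, symmetric]]

lemma zchoose_mult_fact: "(x zchoose k) * fact k = (\<Prod>i = 0..<k. x - int i)"
  unfolding zchoose_eq_gbinomial by (rule gbinomial_int_mult_fact')

end

theory Submission
  imports Defs
begin

text \<open>
  Let \<open>P k\<close> be the product of binomials. Since \<open>f 0 = 0\<close> and \<open>n\<^sup>3\<close> divides \<open>f n\<close>, summation by parts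
  turns the left-hand side into the sum of \<open>f k * (P (k - 1) - P k)\<close> over \<open>0 < k < n\<close>, and the
  congruence then holds term by term. Indeed each factor \<open>Q\<close> of \<open>P\<close> satisfies
  \<open>k\<^sup>2 * Q k = (k\<^sup>2 - a\<^sup>2 * n\<^sup>2) * Q (k - 1)\<close>. Writing \<open>n = d * u\<close> and \<open>k = d * w\<close> with \<open>d = gcd n k\<close>,
  the same holds with \<open>w\<close>, \<open>u\<close> for \<open>k\<close>, \<open>n\<close>, and \<open>w\<close> is invertible modulo \<open>u\<close>. So
  \<open>w\<^sup>2 * (P (k - 1) - P k)\<close> is congruent to \<open>u\<^sup>2 * (\<Sum>a\<^sup>2) * P k\<close> modulo \<open>u\<^sup>4\<close>, and \<open>k\<^sup>3\<close>, which
  divides \<open>f k\<close>, supplies the factor \<open>d\<^sup>3\<close>.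
\<close>

lemma zchoose_Suc: "int (Suc k) * (x zchoose Suc k) = (x - int k) * (x zchoose k)"
proof -
  have "(int (Suc k) * (x zchoose Suc k)) * fact k = (x zchoose Suc k) * fact (Suc k)"
    by (simp add: mult_ac)
  also have "\<dots> = (x - int k) * ((x zchoose k) * fact k)"
    by (simp only: zchoose_mult_fact) (simp add: mult_ac)
  finally show ?thesis
    by (simp add: mult.assoc [symmetric])
qed

text \<open>Advancing both binomials multiplies by \<open>b - 1 - k\<close> and
  \<open>- b - 1 - k\<close>, whose product is a difference of squares.\<close>

lemma zchoose_pair_Suc:
  fixes b :: int and k :: nat
  defines "Q \<equiv> \<lambda>k. ((b - 1) zchoose k) * ((- b - 1) zchoose k)"
  shows "int (Suc k) ^ 2 * Q (Suc k) = (int (Suc k) ^ 2 - b ^ 2) * Q k"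
proof -
  have "int (Suc k) ^ 2 * Q (Suc k)
      = (int (Suc k) * ((b - 1) zchoose Suc k)) * (int (Suc k) * ((- b - 1) zchoose Suc k))"
    by (simp add: Q_def power2_eq_square mult_ac del: of_nat_Suc)
  also have "\<dots> = (int (Suc k) ^ 2 - b ^ 2) * Q k"
    unfolding zchoose_Suc by (simp add: Q_def power2_eq_square algebra_simps)
  finally show ?thesis .
qed

text \<open>The factor \<open>x\<close> on the left avoids the exponent \<open>card A - 1\<close>.\<close>

lemma prod_diff_cong_square:
  fixes x y :: int and c :: "'a \<Rightarrow> int"
  assumes "finite A"
  shows "[x * (\<Prod>i\<in>A. x - c i * y) = x ^ card A * (x - (\<Sum>i\<in>A. c i) * y)] (mod y ^ 2)"
  using assms
proof (induction A rule: finite_induct)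
  case empty
  then show ?case by simp
next
  case (insert j A)
  let ?S = "\<Sum>i\<in>A. c i"
  have "[x * (\<Prod>i\<in>insert j A. x - c i * y)
      = (x - c j * y) * (x ^ card A * (x - ?S * y))] (mod y ^ 2)"
    using cong_scalar_left [OF insert.IH, of "x - c j * y"] insert.hyps
    by (simp add: mult_ac)
  also have "(x - c j * y) * (x ^ card A * (x - ?S * y))
      = x ^ card (insert j A) * (x - (\<Sum>i\<in>insert j A. c i) * y) + y ^ 2 * (x ^ card A * c j * ?S)"
    using insert.hyps by (simp add: algebra_simps power2_eq_square)
  also have "[\<dots> = x ^ card (insert j A) * (x - (\<Sum>i\<in>insert j A. c i) * y)] (mod y ^ 2)"
    by (simp add: cong_iff_dvd_diff)
  finally show ?case .
qed

text \<open>Only the recursion matters, so \<open>p\<close> and \<open>q\<close> stay abstract. The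
  cube of \<open>k\<close> covers the \<open>w ^ 2\<close> needed for the congruence and the
  \<open>d ^ 3\<close> that lifts it from \<open>u\<close> to \<open>n\<close>.\<close>

lemma cube_step_cong:
  fixes n k :: int and A :: "'a set" and a p q :: "'a \<Rightarrow> int"
  assumes "finite A" "k \<noteq> 0"
    and rec: "\<And>i. i \<in> A \<Longrightarrow> k ^ 2 * q i = (k ^ 2 - (a i * n) ^ 2) * p i"
  shows "[k ^ 3 * ((\<Prod>i\<in>A. p i) - (\<Prod>i\<in>A. q i))
        = n ^ 2 * (\<Sum>i\<in>A. a i ^ 2) * (k * (\<Prod>i\<in>A. q i))] (mod n ^ 3)"
proof -
  define d u w where "d = gcd n k" and "u = n div d" and "w = k div d"
  have d: "d \<noteq> 0" and n: "n = d * u" and k: "k = d * w"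
    using \<open>k \<noteq> 0\<close> by (auto simp: d_def u_def w_def)
  have "coprime w u"
    unfolding u_def w_def d_def
    using div_gcd_coprime [of n k] \<open>k \<noteq> 0\<close> by (simp add: coprime_commute)
  let ?P = "\<Prod>i\<in>A. p i" and ?Q = "\<Prod>i\<in>A. q i" and ?S = "\<Sum>i\<in>A. a i ^ 2"
  have "w ^ 2 * q i = (w ^ 2 - a i ^ 2 * u ^ 2) * p i" if "i \<in> A" for i
  proof -
    have "d ^ 2 * (w ^ 2 * q i) = d ^ 2 * ((w ^ 2 - a i ^ 2 * u ^ 2) * p i)"
      using rec [OF that] by (simp add: n k algebra_simps power_mult_distrib)
    with d show ?thesis by simp
  qed
  then have "(\<Prod>i\<in>A. w ^ 2 * q i) = (\<Prod>i\<in>A. (w ^ 2 - a i ^ 2 * u ^ 2) * p i)"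
    by (intro prod.cong) auto
  then have "(w ^ 2) ^ card A * ?Q = (\<Prod>i\<in>A. w ^ 2 - a i ^ 2 * u ^ 2) * ?P"
    by (simp add: prod.distrib)
  \<comment> \<open>The extra \<open>w ^ 2\<close> is the leading factor \<open>x\<close> in
    \<open>prod_diff_cong_square\<close>, applied with \<open>y = u ^ 2\<close>.\<close>
  then have "(w ^ 2) ^ card A * (w ^ 2 * ?Q) = (w ^ 2 * (\<Prod>i\<in>A. w ^ 2 - a i ^ 2 * u ^ 2)) * ?P"
    by (metis mult.assoc mult.left_commute)
  also have "[\<dots> = ((w ^ 2) ^ card A * (w ^ 2 - ?S * u ^ 2)) * ?P] (mod (u ^ 2) ^ 2)"
    by (intro cong_scalar_right prod_diff_cong_square \<open>finite A\<close>)
  finally have "[(w ^ 2) ^ card A * (w ^ 2 * ?Q)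
      = (w ^ 2) ^ card A * ((w ^ 2 - ?S * u ^ 2) * ?P)] (mod (u ^ 2) ^ 2)"
    by (simp add: mult.assoc)
  then have main: "[w ^ 2 * ?Q = (w ^ 2 - ?S * u ^ 2) * ?P] (mod (u ^ 2) ^ 2)"
    using \<open>coprime w u\<close> by (subst (asm) cong_mult_lcancel) auto
  \<comment> \<open>Modulo \<open>u ^ 2\<close> is enough to replace \<open>?P\<close> by
    \<open>?Q\<close> in a term that already carries \<open>u ^ 2\<close>.\<close>
  have "[w ^ 2 * ?Q = (w ^ 2 - ?S * u ^ 2) * ?P] (mod u ^ 2)"
    using main by (rule cong_dvd_modulus) (simp add: le_imp_power_dvd)
  also have "[(w ^ 2 - ?S * u ^ 2) * ?P = w ^ 2 * ?P] (mod u ^ 2)"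
    by (simp add: cong_iff_dvd_diff algebra_simps)
  finally have "[?Q = ?P] (mod u ^ 2)"
    using \<open>coprime w u\<close> by (subst (asm) cong_mult_lcancel) auto
  then obtain s where s: "?P = ?Q + u ^ 2 * s"
    by (meson cong_iff_lin)
  obtain t where t: "(w ^ 2 - ?S * u ^ 2) * ?P = w ^ 2 * ?Q + (u ^ 2) ^ 2 * t"
    using main by (meson cong_iff_lin)
  have "w ^ 2 * (?P - ?Q) = ?S * u ^ 2 * ?P + (u ^ 2) ^ 2 * t"
    using t by (simp add: algebra_simps)
  also have "\<dots> = u ^ 2 * ?S * ?Q + u ^ 3 * (u * (?S * s + t))"
    unfolding s by (simp add: algebra_simps eval_nat_numeral)
  finally have *: "w ^ 2 * (?P - ?Q) = u ^ 2 * ?S * ?Q + u ^ 3 * (u * (?S * s + t))" .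
  have "k ^ 3 * (?P - ?Q) = d ^ 3 * w * (w ^ 2 * (?P - ?Q))"
    by (simp add: k eval_nat_numeral mult_ac)
  also have "\<dots> = n ^ 2 * ?S * (k * ?Q) + n ^ 3 * (w * (u * (?S * s + t)))"
    unfolding * n k by (simp add: algebra_simps eval_nat_numeral)
  finally show ?thesis
    by (simp add: cong_iff_dvd_diff)
qed

lemma sum_diff_mult_by_parts:
  fixes f P :: "nat \<Rightarrow> 'a :: comm_ring"
  shows "(\<Sum>k\<le>N. (f (Suc k) - f k) * P k)
       = f (Suc N) * P N - f 0 * P 0 + (\<Sum>k<N. f (Suc k) * (P k - P (Suc k)))"
  by (induction N) (simp_all add: algebra_simps)

theorem theorem4p2:
  fixes m n :: nat and a :: "nat \<Rightarrow> int" and f :: "nat \<Rightarrow> int"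
  assumes "m \<ge> 1"
    and "\<And>k. int k ^ 3 dvd f k"
    and "n > 0"
  shows "[(\<Sum>k = 0..n - 1. (f (k + 1) - f k) *
             (\<Prod>i = 1..m. ((a i * int n - 1) zchoose k) * ((- a i * int n - 1) zchoose k)))
        = int n ^ 2 * (\<Sum>i = 1..m. a i ^ 2) *
          (\<Sum>k\<in>{0<..<n}. (f k div int k ^ 2) *
             (\<Prod>i = 1..m. ((a i * int n - 1) zchoose k) * ((- a i * int n - 1) zchoose k)))]
        (mod int n ^ 3)"
proof -
  define Q where "Q = (\<lambda>k i. ((a i * int n - 1) zchoose k) * ((- a i * int n - 1) zchoose k))"
  define P where "P = (\<lambda>k. \<Prod>i = 1..m. Q k i)"
  let ?S = "\<Sum>i = 1..m. a i ^ 2"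
  obtain N where N: "n = Suc N"
    using \<open>n > 0\<close> by (cases n) auto
  have f0: "f 0 = 0"
    using assms(2) [of 0] by simp
  have step: "[f (Suc k) * (P k - P (Suc k))
      = int n ^ 2 * ?S * (f (Suc k) div int (Suc k) ^ 2 * P (Suc k))] (mod int n ^ 3)" for k
  proof -
    \<comment> \<open>The cofactor makes the division exact and leaves the single factor
      \<open>k\<close> found on the right of \<open>cube_step_cong\<close>.\<close>
    obtain g where g: "f (Suc k) = int (Suc k) ^ 3 * g"
      using assms(2) [of "Suc k"] by (elim dvdE)
    have div: "f (Suc k) div int (Suc k) ^ 2 = int (Suc k) * g"
    proof -
      have "f (Suc k) = int (Suc k) ^ 2 * (int (Suc k) * g)"
        unfolding g by (simp only: eval_nat_numeral power_Suc mult_ac)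
      then show ?thesis
        by (simp del: of_nat_Suc)
    qed
    have "[int (Suc k) ^ 3 * (P k - P (Suc k))
        = int n ^ 2 * ?S * (int (Suc k) * P (Suc k))] (mod int n ^ 3)"
      unfolding P_def
    proof (rule cube_step_cong)
      show "int (Suc k) ^ 2 * Q (Suc k) i = (int (Suc k) ^ 2 - (a i * int n) ^ 2) * Q k i" for i
        using zchoose_pair_Suc [of k "a i * int n"] by (simp add: Q_def)
    qed simp_all
    from cong_scalar_left [OF this, of g] show ?thesis
      unfolding div unfolding g by (simp only: mult_ac)
  qed
  have "(\<Sum>k = 0..n - 1. (f (k + 1) - f k) * P k)
      = f n * P N + (\<Sum>k<N. f (Suc k) * (P k - P (Suc k)))"
    using sum_diff_mult_by_parts [of f P N] by (simp add: N f0 atLeast0AtMost)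
  \<comment> \<open>The \<open>0\<close> replaces the boundary term
    \<open>f n * P N\<close>.\<close>
  also have "[\<dots> = 0 + (\<Sum>k<N. int n ^ 2 * ?S * (f (Suc k) div int (Suc k) ^ 2 * P (Suc k)))]
      (mod int n ^ 3)"
  proof (rule cong_add)
    show "[f n * P N = 0] (mod int n ^ 3)"
      using assms(2) [of n] by (simp add: cong_0_iff)
  qed (intro cong_sum step)
  also have "0 + (\<Sum>k<N. int n ^ 2 * ?S * (f (Suc k) div int (Suc k) ^ 2 * P (Suc k)))
      = int n ^ 2 * ?S * (\<Sum>k\<in>Suc ` {..<N}. f k div int k ^ 2 * P k)"
    by (simp add: sum.reindex sum_distrib_left)
  also have "Suc ` {..<N} = {0<..<n}"
    unfolding N by (auto simp: image_iff gr0_conv_Suc)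
  finally show ?thesis
    by (simp only: P_def Q_def)
qed

end
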